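(* Let the "truth" assumption of the context be satisfied. Moreover, let $\bar\mu_h$ and $\bar\mu_r$ be strict local minima for the optimization problems $\min_{\mu\in\mathcal P}\hat{\mathcal J}_h(\mu)$ and $\min_{\mu\in\mathcal P}\hat{\mathcal J}_r(\mu)$, respectively, where $\bar\mu_h$ satisfies the second-order condition (SOC) of the context. If $\bar\mu_r\in\mathcal B(\bar\mu_h,r(\lambda_{\min}/2))$, then it holds $$\|\bar\mu_h-\bar\mu_r\|_2\le\Delta_\mu(\bar\mu_r):=\frac{2}{\lambda_{\min}}\|\zeta\|_2,$$ where $\zeta=(\zeta_i)\in\mathbb R^P$ with $$\zeta_i:=\begin{cases}-\min\big(0,(\nabla\hat{\mathcal J}_h(\bar\mu_r))_i\big)&\text{if }\bar\mu_{r,i}=(\mu_{\mathsf a})_i,\\-\max\big(0,(\nabla\hat{\mathcal J}_h(\bar\mu_r))_i\big)&\text{if }\bar\mu_{r,i}=(\mu_{\mathsf b})_i,\\-(\nabla\hat{\mathcal J}_h(\bar\mu_r))_i&\text{otherwise}\end{cases}$$ for $i=1,\dots,P$.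
   Context: $V$ is a real Hilbert space with norm $\|\cdot\|$, $V_h\subset V$ a finite-dimensional subspace, $\mathcal P=\{\mu\in\mathbb R^P:\mu_{\mathsf a}\le\mu\le\mu_{\mathsf b}\}$ (componentwise) a compact box. For $\mu\in\mathcal P$: $a_\mu$ is a continuous coercive bilinear form on $V$, $l_\mu,j_\mu$ continuous linear functionals, $k_\mu$ a continuous symmetric bilinear form, $\Theta:\mathcal P\to\mathbb R$, $\mathcal J(u,\mu)=\Theta(\mu)+j_\mu(u)+k_\mu(u,u)$; standing assumptions: $a_\mu,l_\mu,j_\mu,k_\mu$ are parameter separable, and $a_\mu,l_\mu,\mathcal J$ are twice continuously Fréchet differentiable in $\mu$ with locally Lipschitz-continuous second derivatives. The primal and dual solutions $u_\mu,p_\mu\in V$ satisfy $a_\mu(u_\mu,v)=l_\mu(v)$ and $a_\mu(q,p_\mu)=j_\mu(q)+2k_\mu(q,u_\mu)$ for all $v,q\in V$; $u_{h,\mu},p_{h,\mu}\in V_h$ satisfy the same equations with $V$ replaced by $V_h$ (and $u_\mu$ by $u_{h,\mu}$). $d_{\mu_i}$ denotes their derivative with respect to $\mu_i$. $\hat{\mathcal J}_h(\mu)=\mathcal J(u_{h,\mu},\mu)$, and $\hat{\mathcal H}_{h,\mu}(\mu)$ is the Hessian of $\hat{\mathcal J}_h$ at $\mu$. For subspaces $V_r^{\rm pr},V_r^{\rm du}\subset V_h$ (reduced basis spaces), $u_{r,\mu}\in V_r^{\rm pr}$ and $p_{r,\mu}\in V_r^{\rm du}$ solve $a_\mu(u_{r,\mu},v)=l_\mu(v)$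 for all $v\in V_r^{\rm pr}$ and $a_\mu(q,p_{r,\mu})=j_\mu(q)+2k_\mu(q,u_{r,\mu})$ for all $q\in V_r^{\rm du}$; $\hat{\mathcal J}_r(\mu)=\mathcal J(u_{r,\mu},\mu)+l_\mu(p_{r,\mu})-a_\mu(u_{r,\mu},p_{r,\mu})$. **"Truth" assumption.** The discretization errors $\|u_\mu-u_{h,\mu}\|$, $\|p_\mu-p_{h,\mu}\|$, $\|d_{\mu_i}u_\mu-d_{\mu_i}u_{h,\mu}\|$ and $\|d_{\mu_i}p_\mu-d_{\mu_i}p_{h,\mu}\|$ are negligible for all $\mu\in\mathcal P$, $1\le i\le P$. **Second-order condition and radius.** The critical cone at $\bar\mu_h$ is $\mathcal C(\bar\mu_h)=\{\nu\in\mathbb R^P:\exists\,\mu\in\mathcal P,\ c_1>0:\ \nu=c_1(\mu-\bar\mu_h),\ \nabla_\mu\hat{\mathcal J}_h(\bar\mu_h)\cdot\nu=0\}$. The estimate relies on the second-order condition (SOC) $\nu\cdot(\hat{\mathcal H}_{h,\mu}(\bar\mu_h)\cdot\nu)\ge\lambda_{\min}\|\nu\|_2^2$ for all $\nu\in\mathcal C(\bar\mu_h)\setminus\{0\}$, where $\lambda_{\min}>0$ is the smallest eigenvalue of $\hat{\mathcal H}_{h,\mu}(\bar\mu_h)$. Under (SOC), for any $\tilde\lambda$ with $0<\tilde\lambda<\lambda_{\min}$ there exists a radius, denoted $r(\tilde\lambda)>0$, such that for all $\mu\in\mathcal B(\bar\mu_h,r(\tilde\lambda))$, the closed ball of radius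 $r(\tilde\lambda)$ centered at $\bar\mu_h$, one has $\nu\cdot(\hat{\mathcal H}_{h,\mu}(\mu)\cdot\nu)\ge\tilde\lambda\|\nu\|_2^2$ for all $\nu\in\mathcal C(\bar\mu_h)\setminus\{0\}$. The radius $r(\lambda_{\min}/2)$ in the claim is the one for $\tilde\lambda=\lambda_{\min}/2$. *)

theory Defs
  imports "HOL-Analysis.Analysis"
begin

text \<open>
  Parameters are vectors of type real^'p, and the Hilbert space V is the type 'v. Continuous
  functionals on V are bounded linear functions (blinfun) into real, continuous bilinear forms
  are bounded linear functions into these. Only the values of the data at parameters in the box
  P matter: all derivatives with respect to the parameter are taken within P, one-sided on its
  boundary. They are uniquely determined when P has nonempty interior.
\<close>

definition param_separable :: "(real^'p) set \<Rightarrow> (real^'p \<Rightarrow> 'b::real_vector) \<Rightarrow> bool" where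
  "param_separable P F \<longleftrightarrow>
     (\<exists>(Q::nat) (\<theta> :: nat \<Rightarrow> real^'p \<Rightarrow> real) (c :: nat \<Rightarrow> 'b).
        \<forall>\<mu>\<in>P. F \<mu> = (\<Sum>q<Q. \<theta> q \<mu> *\<^sub>R c q))"

definition C2_loc_lipschitz_on :: "(real^'p) set \<Rightarrow> (real^'p \<Rightarrow> 'b::real_normed_vector) \<Rightarrow> bool" where
  "C2_loc_lipschitz_on P F \<longleftrightarrow>
     (\<exists>(F' :: real^'p \<Rightarrow> (real^'p) \<Rightarrow>\<^sub>L 'b) (F'' :: real^'p \<Rightarrow> (real^'p) \<Rightarrow>\<^sub>L (real^'p) \<Rightarrow>\<^sub>L 'b).
        (\<forall>\<mu>\<in>P. (F has_derivative blinfun_apply (F' \<mu>)) (at \<mu> within P)) \<and>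
        (\<forall>\<mu>\<in>P. (F' has_derivative blinfun_apply (F'' \<mu>)) (at \<mu> within P)) \<and>
        continuous_on P F'' \<and>
        (\<forall>\<mu>\<in>P. \<exists>\<delta>>0. \<exists>L. L-lipschitz_on (P \<inter> ball \<mu> \<delta>) F''))"

definition coercive :: "('v::real_normed_vector \<Rightarrow>\<^sub>L 'v \<Rightarrow>\<^sub>L real) \<Rightarrow> bool" where
  "coercive b \<longleftrightarrow> (\<exists>\<alpha>>0. \<forall>v. \<alpha> * (norm v)\<^sup>2 \<le> b v v)"

definition cost ::
  "(real^'p \<Rightarrow> real) \<Rightarrow> (real^'p \<Rightarrow> 'v \<Rightarrow>\<^sub>L real) \<Rightarrow> (real^'p \<Rightarrow> 'v \<Rightarrow>\<^sub>L 'v \<Rightarrow>\<^sub>L real) \<Rightarrow>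
   'v::real_normed_vector \<Rightarrow> real^'p \<Rightarrow> real" where
  "cost \<Theta> j k u \<mu> = \<Theta> \<mu> + j \<mu> u + k \<mu> u u"

text \<open>
  Galerkin solutions on a subspace W: UNIV gives the exact solutions, Vh the discrete ones and
  the reduced spaces the reduced ones. The state u entering the dual equation is an argument,
  because in the reduced model it lives in a different space.
\<close>

definition primal_sol ::
  "(real^'p \<Rightarrow> 'v \<Rightarrow>\<^sub>L 'v \<Rightarrow>\<^sub>L real) \<Rightarrow> (real^'p \<Rightarrow> 'v \<Rightarrow>\<^sub>L real) \<Rightarrow>
   'v::real_normed_vector set \<Rightarrow> real^'p \<Rightarrow> 'v" where
  "primal_sol a l W \<mu> = (THE u. u \<in> W \<and> (\<forall>v\<in>W. a \<mu> u v = l \<mu> v))"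

definition dual_sol ::
  "(real^'p \<Rightarrow> 'v \<Rightarrow>\<^sub>L 'v \<Rightarrow>\<^sub>L real) \<Rightarrow> (real^'p \<Rightarrow> 'v \<Rightarrow>\<^sub>L real) \<Rightarrow>
   (real^'p \<Rightarrow> 'v \<Rightarrow>\<^sub>L 'v \<Rightarrow>\<^sub>L real) \<Rightarrow> 'v::real_normed_vector set \<Rightarrow> 'v \<Rightarrow> real^'p \<Rightarrow> 'v" where
  "dual_sol a j k W u \<mu> = (THE p. p \<in> W \<and> (\<forall>q\<in>W. a \<mu> q p = j \<mu> q + 2 * k \<mu> q u))"

definition J_full ::
  "(real^'p \<Rightarrow> 'v \<Rightarrow>\<^sub>L 'v \<Rightarrow>\<^sub>L real) \<Rightarrow> (real^'p \<Rightarrow> 'v \<Rightarrow>\<^sub>L real) \<Rightarrow> (real^'p \<Rightarrow> real) \<Rightarrow>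
   (real^'p \<Rightarrow> 'v \<Rightarrow>\<^sub>L real) \<Rightarrow> (real^'p \<Rightarrow> 'v \<Rightarrow>\<^sub>L 'v \<Rightarrow>\<^sub>L real) \<Rightarrow>
   'v::real_normed_vector set \<Rightarrow> real^'p \<Rightarrow> real" where
  "J_full a l \<Theta> j k Vh \<mu> = cost \<Theta> j k (primal_sol a l Vh \<mu>) \<mu>"

definition J_red ::
  "(real^'p \<Rightarrow> 'v \<Rightarrow>\<^sub>L 'v \<Rightarrow>\<^sub>L real) \<Rightarrow> (real^'p \<Rightarrow> 'v \<Rightarrow>\<^sub>L real) \<Rightarrow> (real^'p \<Rightarrow> real) \<Rightarrow>
   (real^'p \<Rightarrow> 'v \<Rightarrow>\<^sub>L real) \<Rightarrow> (real^'p \<Rightarrow> 'v \<Rightarrow>\<^sub>L 'v \<Rightarrow>\<^sub>L real) \<Rightarrow>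
   'v::real_normed_vector set \<Rightarrow> 'v set \<Rightarrow> real^'p \<Rightarrow> real" where
  "J_red a l \<Theta> j k Vpr Vdu \<mu> =
     (let u = primal_sol a l Vpr \<mu>; p = dual_sol a j k Vdu u \<mu>
      in cost \<Theta> j k u \<mu> + l \<mu> p - a \<mu> u p)"

definition param_deriv ::
  "(real^'p) set \<Rightarrow> 'p \<Rightarrow> (real^'p \<Rightarrow> 'b::real_normed_vector) \<Rightarrow> real^'p \<Rightarrow> 'b" where
  "param_deriv P i F \<mu> = frechet_derivative F (at \<mu> within P) (axis i 1)"

definition gradient :: "(real^'p) set \<Rightarrow> (real^'p \<Rightarrow> real) \<Rightarrow> real^'p \<Rightarrow> real^'p" where
  "gradient P f \<mu> = (\<chi> i. param_deriv P i f \<mu>)"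

definition hessian :: "(real^'p) set \<Rightarrow> (real^'p \<Rightarrow> real) \<Rightarrow> real^'p \<Rightarrow> real^'p^'p" where
  "hessian P f \<mu> = (\<chi> i j. param_deriv P i (param_deriv P j f) \<mu>)"

text \<open>
  The threshold \<epsilon> makes ``negligible'' precise: all discretization errors are at most \<epsilon>.
  The case \<epsilon> = 0 says that the discretization is exact.
\<close>

definition truth_assumption ::
  "real \<Rightarrow> (real^'p) set \<Rightarrow> (real^'p \<Rightarrow> 'v \<Rightarrow>\<^sub>L 'v \<Rightarrow>\<^sub>L real) \<Rightarrow> (real^'p \<Rightarrow> 'v \<Rightarrow>\<^sub>L real) \<Rightarrow>
   (real^'p \<Rightarrow> 'v \<Rightarrow>\<^sub>L real) \<Rightarrow> (real^'p \<Rightarrow> 'v \<Rightarrow>\<^sub>L 'v \<Rightarrow>\<^sub>L real) \<Rightarrow>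
   'v::real_normed_vector set \<Rightarrow> bool" where
  "truth_assumption \<epsilon> P a l j k Vh \<longleftrightarrow>
     (let u = primal_sol a l UNIV; uh = primal_sol a l Vh;
          p = (\<lambda>\<mu>. dual_sol a j k UNIV (u \<mu>) \<mu>); ph = (\<lambda>\<mu>. dual_sol a j k Vh (uh \<mu>) \<mu>)
      in \<forall>\<mu>\<in>P. norm (u \<mu> - uh \<mu>) \<le> \<epsilon> \<and> norm (p \<mu> - ph \<mu>) \<le> \<epsilon> \<and>
           (\<forall>i. norm (param_deriv P i u \<mu> - param_deriv P i uh \<mu>) \<le> \<epsilon> \<and>
                norm (param_deriv P i p \<mu> - param_deriv P i ph \<mu>) \<le> \<epsilon>))"

definition strict_local_min_on :: "(real^'p) set \<Rightarrow> (real^'p \<Rightarrow> real) \<Rightarrow> real^'p \<Rightarrow> bool" where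
  "strict_local_min_on P f x \<longleftrightarrow>
     x \<in> P \<and> (\<exists>\<delta>>0. \<forall>y\<in>P \<inter> ball x \<delta>. y \<noteq> x \<longrightarrow> f x < f y)"

definition critical_cone :: "(real^'p) set \<Rightarrow> (real^'p \<Rightarrow> real) \<Rightarrow> real^'p \<Rightarrow> (real^'p) set" where
  "critical_cone P f x =
     {\<nu>. \<exists>\<mu>\<in>P. \<exists>c>0. \<nu> = c *\<^sub>R (\<mu> - x) \<and> gradient P f x \<bullet> \<nu> = 0}"

definition smallest_eigenvalue :: "real^'p^'p \<Rightarrow> real \<Rightarrow> bool" where
  "smallest_eigenvalue A lam \<longleftrightarrow>
     (\<exists>v. v \<noteq> 0 \<and> A *v v = lam *\<^sub>R v) \<and>
     (\<forall>\<kappa>. (\<exists>v. v \<noteq> 0 \<and> A *v v = \<kappa> *\<^sub>R v) \<longrightarrow> lam \<le> \<kappa>)"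

definition coercive_on_cone :: "(real^'p) set \<Rightarrow> real^'p^'p \<Rightarrow> real \<Rightarrow> bool" where
  "coercive_on_cone C A lam \<longleftrightarrow> (\<forall>\<nu>\<in>C - {0}. lam * (norm \<nu>)\<^sup>2 \<le> \<nu> \<bullet> (A *v \<nu>))"

definition second_order_condition ::
  "(real^'p) set \<Rightarrow> (real^'p \<Rightarrow> real) \<Rightarrow> real^'p \<Rightarrow> real \<Rightarrow> bool" where
  "second_order_condition P f x lam_min \<longleftrightarrow>
     smallest_eigenvalue (hessian P f x) lam_min \<and> 0 < lam_min \<and>
     coercive_on_cone (critical_cone P f x) (hessian P f x) lam_min"

text \<open>
  A radius function r assigns to each lam below the smallest eigenvalue a radius of coercivity.
  The closed ball is intersected with P, where the Hessian is defined. This property alone does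
  not determine r, nor does it suffice for an error bound: if the critical cone is {0}, every
  positive r has it. So r has to be quantified existentially, but before the reduced model.
\<close>

definition coercivity_radius ::
  "(real^'p) set \<Rightarrow> (real^'p \<Rightarrow> real) \<Rightarrow> real^'p \<Rightarrow> real \<Rightarrow> (real \<Rightarrow> real) \<Rightarrow> bool" where
  "coercivity_radius P f x lam_min r \<longleftrightarrow>
     (\<forall>lam. 0 < lam \<and> lam < lam_min \<longrightarrow>
        0 < r lam \<and>
        (\<forall>\<mu>\<in>P \<inter> cball x (r lam). coercive_on_cone (critical_cone P f x) (hessian P f \<mu>) lam))"

definition zeta :: "real^'p \<Rightarrow> real^'p \<Rightarrow> (real^'p \<Rightarrow> real) \<Rightarrow> real^'p \<Rightarrow> real^'p" where
  "zeta \<mu>a \<mu>b f \<mu> =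
     (\<chi> i. let g = gradient (cbox \<mu>a \<mu>b) f \<mu> $ i in
           if \<mu> $ i = \<mu>a $ i then - min 0 g
           else if \<mu> $ i = \<mu>b $ i then - max 0 g
           else - g)"

end

theory Submission
  imports Defs
begin

text \<open>
  In a basis of Vh, the discrete state solves a finite linear system with twice continuously
  differentiable coefficients, so the reduced functional is twice continuously differentiable on
  the box and its Hessian is symmetric there, by Schwarz on the interior and continuity up to the
  boundary. For a symmetric matrix the smallest eigenvalue bounds the Rayleigh quotient, so the
  Hessian at the minimum is coercive in all directions, not only on the critical cone, and by
  continuity it stays so nearby; this defines the radius. With d the difference of the two
  parameters, coercivity along the segment, the variational inequality at the discrete minimum and
  the sign pattern of zeta give (lam_min / 2) |d|^2 \<le> |zeta| |d|.
\<close>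

section \<open>Calculus of k times differentiable real functions on a set\<close>

text \<open>
  Regularity is tested one direction at a time, which keeps all derivatives real-valued so that
  product and quotient rules suffice.
\<close>

primrec Ck_on :: "nat \<Rightarrow> 'a::real_normed_vector set \<Rightarrow> ('a \<Rightarrow> real) \<Rightarrow> bool" where
  "Ck_on 0 S f \<longleftrightarrow> continuous_on S f"
| "Ck_on (Suc n) S f \<longleftrightarrow>
     (\<exists>f'. (\<forall>x\<in>S. (f has_derivative f' x) (at x within S)) \<and> (\<forall>h. Ck_on n S (\<lambda>x. f' x h)))"

lemma Ck_on_SucI:
  assumes "\<And>x. x \<in> S \<Longrightarrow> (f has_derivative f' x) (at x within S)"
    and "\<And>h. Ck_on n S (\<lambda>x. f' x h)"
  shows "Ck_on (Suc n) S f"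
  using assms by auto

lemma Ck_on_Suc_imp: "Ck_on (Suc n) S f \<Longrightarrow> Ck_on n S f"
proof (induction n arbitrary: f)
  case 0
  then show ?case
    by (auto intro: has_derivative_continuous_on)
next
  case (Suc n)
  from Suc.prems obtain f' where
    "\<forall>x\<in>S. (f has_derivative f' x) (at x within S)" "\<forall>h. Ck_on (Suc n) S (\<lambda>x. f' x h)"
    by auto
  note f' = this[rule_format]
  show ?case
    using f' Suc.IH by (blast intro: Ck_on_SucI)
qed

text \<open>All derivatives are taken within \<open>S\<close>, so values off \<open>S\<close> do not
  affect them.\<close>

lemma Ck_on_cong:
  assumes "Ck_on n S f" and "\<And>x. x \<in> S \<Longrightarrow> g x = f x"
  shows "Ck_on n S g"
proof (cases n)
  case 0
  then show ?thesis
    using assms continuous_on_cong[of S S g f] by simp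
next
  case (Suc m)
  with assms(1) obtain f' where
    "\<forall>x\<in>S. (f has_derivative f' x) (at x within S)" "\<forall>h. Ck_on m S (\<lambda>x. f' x h)"
    by auto
  note f' = this[rule_format]
  show ?thesis
    unfolding Suc
    by (rule Ck_on_SucI[OF has_derivative_transform[OF _ assms(2) f'(1)] f'(2)])
qed

lemma Ck_on_const: "Ck_on n S (\<lambda>x. c)"
proof (induction n arbitrary: c)
  case (Suc n)
  show ?case
    by (rule Ck_on_SucI[where f' = "\<lambda>x h. 0"]) (auto intro: Suc)
qed simp

lemma Ck_on_add:
  assumes "Ck_on n S f" "Ck_on n S g"
  shows "Ck_on n S (\<lambda>x. f x + g x)"
  using assms
proof (induction n arbitrary: f g)
  case 0
  then show ?case by (simp add: continuous_on_add)
next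
  case (Suc n)
  obtain f' where
    "\<forall>x\<in>S. (f has_derivative f' x) (at x within S)" "\<forall>h. Ck_on n S (\<lambda>x. f' x h)"
    using Suc.prems(1) by auto
  note f' = this[rule_format]
  obtain g' where
    "\<forall>x\<in>S. (g has_derivative g' x) (at x within S)" "\<forall>h. Ck_on n S (\<lambda>x. g' x h)"
    using Suc.prems(2) by auto
  note g' = this[rule_format]
  show ?case
    by (rule Ck_on_SucI[where f' = "\<lambda>x h. f' x h + g' x h"])
      (auto intro: f' g' Suc.IH has_derivative_add)
qed

lemma Ck_on_mult:
  assumes "Ck_on n S f" "Ck_on n S g"
  shows "Ck_on n S (\<lambda>x. f x * g x)"
  using assms
proof (induction n arbitrary: f g)
  case 0
  then show ?case by (simp add: continuous_on_mult)
next
  case (Suc n)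
  obtain f' where
    "\<forall>x\<in>S. (f has_derivative f' x) (at x within S)" "\<forall>h. Ck_on n S (\<lambda>x. f' x h)"
    using Suc.prems(1) by auto
  note f' = this[rule_format]
  obtain g' where
    "\<forall>x\<in>S. (g has_derivative g' x) (at x within S)" "\<forall>h. Ck_on n S (\<lambda>x. g' x h)"
    using Suc.prems(2) by auto
  note g' = this[rule_format]
  show ?case
  proof (rule Ck_on_SucI[where f' = "\<lambda>x h. f x * g' x h + f' x h * g x"])
    show "((\<lambda>x. f x * g x) has_derivative (\<lambda>h. f x * g' x h + f' x h * g x)) (at x within S)"
      if "x \<in> S" for x
      using has_derivative_mult[OF f'(1)[OF that] g'(1)[OF that]] .
    show "Ck_on n S (\<lambda>x. f x * g' x h + f' x h * g x)" for h
      by (intro Ck_on_add Suc.IH f' g' Suc.prems[THEN Ck_on_Suc_imp])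
  qed
qed

lemma Ck_on_inverse:
  assumes "Ck_on n S f" "\<And>x. x \<in> S \<Longrightarrow> f x \<noteq> 0"
  shows "Ck_on n S (\<lambda>x. inverse (f x))"
  using assms
proof (induction n arbitrary: f)
  case 0
  then show ?case by (simp add: continuous_on_inverse)
next
  case (Suc n)
  obtain f' where
    "\<forall>x\<in>S. (f has_derivative f' x) (at x within S)" "\<forall>h. Ck_on n S (\<lambda>x. f' x h)"
    using Suc.prems(1) by auto
  note f' = this[rule_format]
  \<comment> \<open>The derivative of the reciprocal contains the reciprocal again. Its regularity
    of order \<open>n\<close> comes from the induction hypothesis, with \<open>f\<close> itself
    lowered to order \<open>n\<close>.\<close>
  have inv: "Ck_on n S (\<lambda>x. inverse (f x))"
    using Suc.IH Suc.prems Ck_on_Suc_imp by blast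
  show ?case
  proof (rule Ck_on_SucI[where f' = "\<lambda>x h. -1 * (inverse (f x) * f' x h * inverse (f x))"])
    show "((\<lambda>x. inverse (f x)) has_derivative (\<lambda>h. -1 * (inverse (f x) * f' x h * inverse (f x))))
        (at x within S)" if "x \<in> S" for x
      using Deriv.has_derivative_inverse[OF Suc.prems(2) f'(1)] that by simp
    show "Ck_on n S (\<lambda>x. -1 * (inverse (f x) * f' x h * inverse (f x)))" for h
      by (intro Ck_on_mult Ck_on_const inv f')
  qed
qed

lemma Ck_on_diff:
  assumes "Ck_on n S f" "Ck_on n S g"
  shows "Ck_on n S (\<lambda>x. f x - g x)"
  using Ck_on_add[OF assms(1) Ck_on_mult[OF Ck_on_const[of n S "-1"] assms(2)]] by simp

lemma Ck_on_divide:
  assumes "Ck_on n S f" "Ck_on n S g" "\<And>x. x \<in> S \<Longrightarrow> g x \<noteq> 0"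
  shows "Ck_on n S (\<lambda>x. f x / g x)"
  using Ck_on_mult[OF assms(1) Ck_on_inverse[OF assms(2,3)]] by (simp add: divide_inverse)

lemma Ck_on_sum:
  assumes "\<And>i. i \<in> I \<Longrightarrow> Ck_on n S (f i)"
  shows "Ck_on n S (\<lambda>x. \<Sum>i\<in>I. f i x)"
  using assms by (induction I rule: infinite_finite_induct) (auto intro: Ck_on_const Ck_on_add)

text \<open>Bounded linear maps commute with differentiation. With evaluation at fixed vectors as
  \<open>L\<close>, operator-valued data turn into scalar coefficients such as
  \<open>a \<mu> b c\<close>.\<close>

lemma C2_loc_lipschitz_on_imp_Ck_on:
  fixes F :: "real^'p \<Rightarrow> 'b::real_normed_vector"
  assumes "C2_loc_lipschitz_on P F" and L: "bounded_linear (L :: 'b \<Rightarrow> real)"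
  shows "Ck_on 2 P (\<lambda>\<mu>. L (F \<mu>))"
proof -
  obtain F' F'' where
    F': "\<And>\<mu>. \<mu> \<in> P \<Longrightarrow> (F has_derivative blinfun_apply (F' \<mu>)) (at \<mu> within P)"
    and F'': "\<And>\<mu>. \<mu> \<in> P \<Longrightarrow> (F' has_derivative blinfun_apply (F'' \<mu>)) (at \<mu> within P)"
    and cont: "continuous_on P F''"
    using assms(1) unfolding C2_loc_lipschitz_on_def by blast
  have "Ck_on (Suc (Suc 0)) P (\<lambda>\<mu>. L (F \<mu>))"
  proof (rule Ck_on_SucI[where f' = "\<lambda>\<mu> h. L (F' \<mu> h)"])
    show "((\<lambda>\<mu>. L (F \<mu>)) has_derivative (\<lambda>h. L (F' \<mu> h))) (at \<mu> within P)" if "\<mu> \<in> P" for \<mu>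
      using bounded_linear.has_derivative[OF L F'[OF that]] .
    fix h :: "real^'p"
    have Lh: "bounded_linear (\<lambda>A. L (blinfun_apply A h))"
      by (intro bounded_linear_compose[OF L] blinfun.bounded_linear_left)
    show "Ck_on (Suc 0) P (\<lambda>\<mu>. L (F' \<mu> h))"
    proof (rule Ck_on_SucI[where f' = "\<lambda>\<mu> g. L (F'' \<mu> g h)"])
      show "((\<lambda>\<mu>. L (F' \<mu> h)) has_derivative (\<lambda>g. L (F'' \<mu> g h))) (at \<mu> within P)" if "\<mu> \<in> P" for \<mu>
        using bounded_linear.has_derivative[OF Lh F''[OF that]] .
      show "Ck_on 0 P (\<lambda>\<mu>. L (F'' \<mu> g h))" for g
        by (simp, intro bounded_linear.continuous_on[OF L] continuous_intros cont)
    qed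
  qed
  then show ?thesis by (simp add: numeral_2_eq_2 del: Ck_on.simps)
qed

section \<open>Smooth dependence of the Galerkin solution and the cost on the parameter\<close>

text \<open>
  Adding a basis vector b0 amounts to one step of block elimination: replacing b0 by its
  Galerkin residual e leaves the old equations untouched, and the new coefficient t is a
  quotient whose denominator is bounded away from 0 pointwise by coercivity.
\<close>

lemma galerkin_coefficients_Ck_on:
  fixes a :: "'a::real_normed_vector \<Rightarrow> 'v::real_normed_vector \<Rightarrow>\<^sub>L 'v \<Rightarrow>\<^sub>L real"
  assumes "finite B" "independent B"
    and pos: "\<And>\<mu> v. \<mu> \<in> P \<Longrightarrow> v \<noteq> 0 \<Longrightarrow> a \<mu> v v > 0"
    and a: "\<And>b c. Ck_on n P (\<lambda>\<mu>. a \<mu> b c)"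
    and m: "\<And>c. Ck_on n P (\<lambda>\<mu>. m \<mu> c)"
  shows "\<exists>x. (\<forall>b. Ck_on n P (x b)) \<and>
    (\<forall>\<mu>\<in>P. \<forall>c\<in>B. a \<mu> (\<Sum>b\<in>B. x b \<mu> *\<^sub>R b) c = m \<mu> c)"
  using assms(1,2) m
proof (induction B arbitrary: m rule: finite_induct)
  case empty
  then show ?case by (auto intro: exI[of _ "\<lambda>_ _. 0"] Ck_on_const)
next
  case (insert b0 B)
  have indep: "independent B" and b0: "b0 \<notin> span B"
    using insert.prems(1) insert.hyps(2) by (auto simp: independent_insert)
  obtain x where x: "\<And>b. Ck_on n P (x b)"
    "\<And>\<mu> c. \<mu> \<in> P \<Longrightarrow> c \<in> B \<Longrightarrow> a \<mu> (\<Sum>b\<in>B. x b \<mu> *\<^sub>R b) c = m \<mu> c"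
    using insert.IH[OF indep, of m] insert.prems(2) by blast
  \<comment> \<open>The induction runs over all right-hand sides, so it also covers
    \<open>a \<mu> b0\<close>. The result is the Galerkin projection of \<open>b0\<close> onto
    \<open>span B\<close>, needed for the residual \<open>e\<close>.\<close>
  obtain y where y: "\<And>b. Ck_on n P (y b)"
    "\<And>\<mu> c. \<mu> \<in> P \<Longrightarrow> c \<in> B \<Longrightarrow> a \<mu> (\<Sum>b\<in>B. y b \<mu> *\<^sub>R b) c = a \<mu> b0 c"
    using insert.IH[OF indep, of "\<lambda>\<mu> c. a \<mu> b0 c"] a by blast
  define w where "w \<mu> = (\<Sum>b\<in>B. x b \<mu> *\<^sub>R b)" for \<mu>
  define e where "e \<mu> = b0 - (\<Sum>b\<in>B. y b \<mu> *\<^sub>R b)" for \<mu>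
  have eB: "a \<mu> (e \<mu>) c = 0" if "\<mu> \<in> P" "c \<in> B" for \<mu> c
    using y(2)[OF that] by (simp add: e_def blinfun.diff_left blinfun.diff_right)
  \<comment> \<open>The residual is nonzero because \<open>b0\<close> lies outside
    \<open>span B\<close>. Expanding only the second argument of
    \<open>a \<mu> (e \<mu>) (e \<mu>)\<close>, the terms from \<open>B\<close> vanish by
    \<open>eB\<close>.\<close>
  have eb0: "a \<mu> (e \<mu>) b0 > 0" if "\<mu> \<in> P" for \<mu>
  proof -
    have "e \<mu> \<noteq> 0"
      using b0 by (auto simp: e_def intro: span_sum span_scale span_base)
    then have "0 < a \<mu> (e \<mu>) (e \<mu>)" using pos that by blast
    also have "a \<mu> (e \<mu>) (e \<mu>) = a \<mu> (e \<mu>) b0 - (\<Sum>b\<in>B. y b \<mu> * a \<mu> (e \<mu>) b)"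
      by (subst (2) e_def) (simp add: blinfun.diff_right blinfun.sum_right blinfun.scaleR_right)
    also have "\<dots> = a \<mu> (e \<mu>) b0" using eB that by simp
    finally show ?thesis .
  qed
  \<comment> \<open>Solves the one remaining equation, tested with \<open>b0\<close>, for the
    multiple of \<open>e\<close> to be added to \<open>w\<close>.\<close>
  define t where "t \<mu> = (m \<mu> b0 - a \<mu> (w \<mu>) b0) / a \<mu> (e \<mu>) b0" for \<mu>
  have aw: "a \<mu> (w \<mu>) b0 = (\<Sum>b\<in>B. x b \<mu> * a \<mu> b b0)" for \<mu>
    by (simp add: w_def blinfun.sum_left blinfun.sum_right blinfun.scaleR_left blinfun.scaleR_right)
  have ae: "a \<mu> (e \<mu>) b0 = a \<mu> b0 b0 - (\<Sum>b\<in>B. y b \<mu> * a \<mu> b b0)" for \<mu>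
    by (simp add: e_def blinfun.sum_left blinfun.sum_right blinfun.scaleR_left blinfun.scaleR_right
        blinfun.diff_left blinfun.diff_right)
  have "Ck_on n P (\<lambda>\<mu>. (m \<mu> b0 - a \<mu> (w \<mu>) b0) / a \<mu> (e \<mu>) b0)"
  proof (rule Ck_on_divide)
    show "Ck_on n P (\<lambda>\<mu>. m \<mu> b0 - a \<mu> (w \<mu>) b0)"
      unfolding aw by (intro Ck_on_diff Ck_on_sum Ck_on_mult x a insert.prems)
    show "Ck_on n P (\<lambda>\<mu>. a \<mu> (e \<mu>) b0)"
      unfolding ae by (intro Ck_on_diff Ck_on_sum Ck_on_mult y a)
  qed (use eb0 in force)
  then have t: "Ck_on n P t"
    unfolding t_def[abs_def] .
  define z where "z b = (if b = b0 then t else (\<lambda>\<mu>. x b \<mu> - t \<mu> * y b \<mu>))" for b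
  have zw: "(\<Sum>b\<in>insert b0 B. z b \<mu> *\<^sub>R b) = w \<mu> + t \<mu> *\<^sub>R e \<mu>" for \<mu>
  proof -
    have "(\<Sum>b\<in>B. z b \<mu> *\<^sub>R b) = (\<Sum>b\<in>B. (x b \<mu> - t \<mu> * y b \<mu>) *\<^sub>R b)"
      using insert.hyps(2) by (auto simp: z_def intro: sum.cong)
    also have "\<dots> = w \<mu> - t \<mu> *\<^sub>R (\<Sum>b\<in>B. y b \<mu> *\<^sub>R b)"
      by (simp add: w_def scaleR_left_diff_distrib sum_subtractf scaleR_sum_right)
    finally show ?thesis
      using insert.hyps by (simp add: z_def e_def algebra_simps)
  qed
  have "\<forall>b. Ck_on n P (z b)"
    by (auto simp: z_def intro!: t Ck_on_diff Ck_on_mult x y)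
  moreover have "a \<mu> (\<Sum>b\<in>insert b0 B. z b \<mu> *\<^sub>R b) c = m \<mu> c"
    if "\<mu> \<in> P" "c \<in> insert b0 B" for \<mu> c
  proof -
    have "a \<mu> (w \<mu> + t \<mu> *\<^sub>R e \<mu>) c = a \<mu> (w \<mu>) c + t \<mu> * a \<mu> (e \<mu>) c"
      by (simp add: blinfun.bilinear_simps)
    also have "\<dots> = m \<mu> c"
      using that eB[of \<mu> c] eb0[of \<mu>] x(2)[of \<mu> c] by (auto simp: t_def w_def)
    finally show ?thesis unfolding zw .
  qed
  ultimately show ?case by blast
qed

text \<open>Two solutions differ by an element of \<open>W\<close>. Testing the difference of their
  equations with that element gives zero energy, so coercivity makes it 0; this uniqueness is what
  \<open>THE\<close> asks for.\<close>

lemma primal_sol_eqI: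
  fixes a :: "real^'p \<Rightarrow> 'v::real_normed_vector \<Rightarrow>\<^sub>L 'v \<Rightarrow>\<^sub>L real" and l :: "real^'p \<Rightarrow> 'v \<Rightarrow>\<^sub>L real"
  assumes W: "subspace W" and "coercive (a \<mu>)"
    and u: "u \<in> W" "\<And>v. v \<in> W \<Longrightarrow> a \<mu> u v = l \<mu> v"
  shows "primal_sol a l W \<mu> = u"
  unfolding primal_sol_def
proof (rule the_equality)
  fix w assume w: "w \<in> W \<and> (\<forall>v\<in>W. a \<mu> w v = l \<mu> v)"
  then have "w - u \<in> W" using W u(1) by (auto intro: subspace_diff)
  then have "a \<mu> (w - u) (w - u) = 0"
    using u(2) w blinfun.diff_left[of "a \<mu> w" "a \<mu> u" "w - u"] by (simp add: blinfun.diff_right[of "a \<mu>"])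
  moreover obtain \<alpha> where "\<alpha> > 0" "\<alpha> * (norm (w - u))\<^sup>2 \<le> a \<mu> (w - u) (w - u)"
    using assms(2) unfolding coercive_def by blast
  ultimately show "w = u"
    by (simp add: mult_le_0_iff)
qed (use u in auto)

lemma finite_spanning_imp_finite_basis:
  assumes "finite B" "span B = V"
  obtains C where "finite C" "independent C" "span C = (V :: 'v::real_vector set)"
proof -
  obtain C where "C \<subseteq> B" "independent C" "B \<subseteq> span C"
    by (rule maximal_independent_subset[of B])
  then show ?thesis
    using that[of C] assms finite_subset[of C B] span_mono[of C B] span_minimal[of B "span C"] by auto
qed

text \<open>In a finite basis of \<open>Vh\<close> the cost of the state is a polynomial in the
  solution coefficients, \<open>\<Theta>\<close>, and the entries of \<open>j\<close> and
  \<open>k\<close>, all of which are twice continuously differentiable.\<close>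

lemma J_full_Ck_on_2:
  fixes a k :: "real^'p \<Rightarrow> 'v::real_normed_vector \<Rightarrow>\<^sub>L 'v \<Rightarrow>\<^sub>L real"
  assumes Vh: "subspace Vh" "finite B" "span B = Vh"
    and coerc: "\<And>\<mu>. \<mu> \<in> P \<Longrightarrow> coercive (a \<mu>)"
    and sym: "\<And>\<mu> u v. \<mu> \<in> P \<Longrightarrow> k \<mu> u v = k \<mu> v u"
    and smooth: "C2_loc_lipschitz_on P a" "C2_loc_lipschitz_on P l"
      "\<And>u. C2_loc_lipschitz_on P (cost \<Theta> j k u)"
  shows "Ck_on 2 P (J_full a l \<Theta> j k Vh)"
proof -
  obtain C where C: "finite C" "independent C" "span C = Vh"
    using finite_spanning_imp_finite_basis Vh by metis
  have cost: "Ck_on 2 P (cost \<Theta> j k u)" for u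
    using C2_loc_lipschitz_on_imp_Ck_on[OF smooth(3) bounded_linear_ident] .
  \<comment> \<open>Smoothness is assumed for the whole cost only. Polarization isolates
    \<open>k\<close>: the combination cancels \<open>j\<close>, and the cost at 0 restores the
    balance of \<open>\<Theta>\<close>. Then \<open>\<Theta>\<close> and \<open>j\<close> follow by
    subtraction.\<close>
  have k: "Ck_on 2 P (\<lambda>\<mu>. k \<mu> u v)" for u v
  proof (rule Ck_on_cong)
    show "Ck_on 2 P (\<lambda>\<mu>. 1/2 * (cost \<Theta> j k (u + v) \<mu> - cost \<Theta> j k u \<mu> - cost \<Theta> j k v \<mu>
        + cost \<Theta> j k 0 \<mu>))"
      by (intro Ck_on_mult Ck_on_const Ck_on_add Ck_on_diff cost)
    show "k \<mu> u v = 1/2 * (cost \<Theta> j k (u + v) \<mu> - cost \<Theta> j k u \<mu> - cost \<Theta> j k v \<mu>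
        + cost \<Theta> j k 0 \<mu>)" if "\<mu> \<in> P" for \<mu>
      using sym[OF that, of v u] by (simp add: cost_def blinfun.bilinear_simps)
  qed
  have \<Theta>: "Ck_on 2 P \<Theta>"
    by (rule Ck_on_cong[OF cost[of 0]]) (simp add: cost_def blinfun.zero_left blinfun.zero_right)
  have j: "Ck_on 2 P (\<lambda>\<mu>. j \<mu> u)" for u
    by (rule Ck_on_cong[OF Ck_on_diff[OF Ck_on_diff[OF cost[of u] \<Theta>] k[of u u]]]) (simp add: cost_def)
  have pos: "a \<mu> v v > 0" if "\<mu> \<in> P" "v \<noteq> 0" for \<mu> v
  proof -
    obtain \<alpha> where "\<alpha> > 0" "\<alpha> * (norm v)\<^sup>2 \<le> a \<mu> v v"
      using coerc[OF \<open>\<mu> \<in> P\<close>] unfolding coercive_def by blast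
    moreover have "0 < \<alpha> * (norm v)\<^sup>2" using \<open>\<alpha> > 0\<close> that(2) by simp
    ultimately show ?thesis by linarith
  qed
  have a: "Ck_on 2 P (\<lambda>\<mu>. a \<mu> b c)" for b c
    by (rule C2_loc_lipschitz_on_imp_Ck_on[OF smooth(1)])
      (intro bounded_linear_compose[OF blinfun.bounded_linear_left] blinfun.bounded_linear_left)
  have l: "Ck_on 2 P (\<lambda>\<mu>. l \<mu> c)" for c
    by (rule C2_loc_lipschitz_on_imp_Ck_on[OF smooth(2)]) (rule blinfun.bounded_linear_left)
  obtain x where x: "\<And>b. Ck_on 2 P (x b)"
    "\<And>\<mu> c. \<mu> \<in> P \<Longrightarrow> c \<in> C \<Longrightarrow> a \<mu> (\<Sum>b\<in>C. x b \<mu> *\<^sub>R b) c = l \<mu> c"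
    using galerkin_coefficients_Ck_on[where P = P and a = a and m = "\<lambda>\<mu>. l \<mu>" and n = 2, OF C(1,2) pos a l]
    by blast
  have sol: "primal_sol a l Vh \<mu> = (\<Sum>b\<in>C. x b \<mu> *\<^sub>R b)" if "\<mu> \<in> P" for \<mu>
  proof (rule primal_sol_eqI[where a = a, OF Vh(1)])
    show "coercive (a \<mu>)" by (rule coerc[OF that])
    show "(\<Sum>b\<in>C. x b \<mu> *\<^sub>R b) \<in> Vh"
      unfolding C(3)[symmetric] by (intro span_sum span_scale span_base)
    fix v assume "v \<in> Vh"
    then have "v \<in> span C" by (simp add: C)
    then show "a \<mu> (\<Sum>b\<in>C. x b \<mu> *\<^sub>R b) v = l \<mu> v"
      by (rule linear_eq_on[OF _ _ _ x(2)[OF that], rotated 2])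
        (auto intro: bounded_linear.linear blinfun.bounded_linear_right)
  qed
  show ?thesis
  proof (rule Ck_on_cong)
    show "Ck_on 2 P (\<lambda>\<mu>. \<Theta> \<mu> + (\<Sum>b\<in>C. x b \<mu> * j \<mu> b) + (\<Sum>b\<in>C. \<Sum>c\<in>C. x b \<mu> * (x c \<mu> * k \<mu> c b)))"
      by (intro Ck_on_add Ck_on_sum Ck_on_mult x j k \<Theta>)
    show "J_full a l \<Theta> j k Vh \<mu> =
        \<Theta> \<mu> + (\<Sum>b\<in>C. x b \<mu> * j \<mu> b) + (\<Sum>b\<in>C. \<Sum>c\<in>C. x b \<mu> * (x c \<mu> * k \<mu> c b))" if "\<mu> \<in> P" for \<mu>
      using that by (simp add: J_full_def cost_def sol blinfun.sum_left blinfun.sum_right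
          blinfun.scaleR_left blinfun.scaleR_right sum_distrib_left)
  qed
qed

section \<open>Symmetry of second derivatives\<close>

lemma mvt_direction:
  fixes f :: "'a::real_normed_vector \<Rightarrow> real"
  assumes f: "\<And>y. y \<in> S \<Longrightarrow> (f has_derivative f' y) (at y within S)"
    and h: "0 \<le> h" and S: "\<And>t. 0 \<le> t \<Longrightarrow> t \<le> h \<Longrightarrow> x + t *\<^sub>R d \<in> S"
  obtains t where "0 \<le> t" "t \<le> h" "f (x + h *\<^sub>R d) - f x = h * f' (x + t *\<^sub>R d) d"
proof -
  have "((\<lambda>t. f (x + t *\<^sub>R d)) has_derivative (\<lambda>s. f' (x + t *\<^sub>R d) (s *\<^sub>R d))) (at t within {0..h})"
    if "0 \<le> t" "t \<le> h" for t
    by (rule has_derivative_in_compose2[where t = S and g = f and g' = f', OF f])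
      (use that in \<open>auto intro!: S derivative_eq_intros\<close>)
  from mvt_very_simple[OF h this] obtain t where
    t: "0 \<le> t" "t \<le> h" "f (x + h *\<^sub>R d) - f x = f' (x + t *\<^sub>R d) (h *\<^sub>R d)"
    by auto
  have "linear (f' (x + t *\<^sub>R d))"
    using has_derivative_linear[OF f[OF S]] t by blast
  then show ?thesis
    using that[of t] t by (simp add: linear_scale)
qed

text \<open>Two applications of the mean value theorem: along \<open>d\<close> to the increment of
  \<open>f\<close> in direction \<open>e\<close>, then along \<open>e\<close> to the directional
  derivative \<open>f' y d\<close>.\<close>

lemma second_difference_mvt:
  fixes f :: "'a::real_normed_vector \<Rightarrow> real"
  assumes f: "\<And>y. y \<in> S \<Longrightarrow> (f has_derivative f' y) (at y within S)"
    and D: "\<And>y. y \<in> S \<Longrightarrow> ((\<lambda>y. f' y d) has_derivative D y) (at y within S)"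
    and h: "0 \<le> h"
    and S: "\<And>s t. 0 \<le> s \<Longrightarrow> s \<le> h \<Longrightarrow> 0 \<le> t \<Longrightarrow> t \<le> h \<Longrightarrow> x + s *\<^sub>R d + t *\<^sub>R e \<in> S"
  obtains s t where "0 \<le> s" "s \<le> h" "0 \<le> t" "t \<le> h"
    "f (x + h *\<^sub>R d + h *\<^sub>R e) - f (x + h *\<^sub>R d) - f (x + h *\<^sub>R e) + f x
      = h * (h * D (x + s *\<^sub>R d + t *\<^sub>R e) e)"
proof -
  \<comment> \<open>The side of the parallelogram along \<open>d\<close>. Both it and its translate
    by \<open>h *\<^sub>R e\<close> lie in \<open>S\<close>, so the increment is differentiable
    within it.\<close>
  define T where "T = (\<lambda>s. x + s *\<^sub>R d) ` {0..h}"
  have T: "(\<lambda>y. y + h *\<^sub>R e) ` T \<subseteq> S" "T \<subseteq> S"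
    using S h S[of _ 0] by (auto simp: T_def)
  have G: "((\<lambda>y. f (y + h *\<^sub>R e) - f y) has_derivative (\<lambda>v. f' (y + h *\<^sub>R e) v - f' y v)) (at y within T)"
    if "y \<in> T" for y
  proof (rule has_derivative_diff)
    show "((\<lambda>y. f (y + h *\<^sub>R e)) has_derivative f' (y + h *\<^sub>R e)) (at y within T)"
      by (rule has_derivative_in_compose2[OF f T(1) that, where f' = "\<lambda>v. v"])
        (auto intro!: derivative_eq_intros)
    show "(f has_derivative f' y) (at y within T)"
      using f that T(2) by (blast intro: has_derivative_subset)
  qed
  obtain s where s: "0 \<le> s" "s \<le> h"
    "f (x + h *\<^sub>R d + h *\<^sub>R e) - f (x + h *\<^sub>R d) - (f (x + h *\<^sub>R e) - f x)
      = h * (f' (x + s *\<^sub>R d + h *\<^sub>R e) d - f' (x + s *\<^sub>R d) d)"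
    by (rule mvt_direction[OF G h, of x d]) (auto simp: T_def)
  obtain t where t: "0 \<le> t" "t \<le> h"
    "f' (x + s *\<^sub>R d + h *\<^sub>R e) d - f' (x + s *\<^sub>R d) d = h * D (x + s *\<^sub>R d + t *\<^sub>R e) e"
    by (rule mvt_direction[OF D h, of "x + s *\<^sub>R d" e]) (use S s in auto)
  show ?thesis
    using that[OF s(1,2) t(1,2)] s(3) t(3) by simp
qed

text \<open>The second difference does not change when \<open>d\<close> and \<open>e\<close> are
  swapped. Evaluating it in both orders equates a value of \<open>D\<close> near \<open>x\<close>
  with a value of \<open>E\<close> near \<open>x\<close>, and continuity carries this to
  \<open>x\<close>.\<close>

lemma symmetric_second_derivative_open:
  fixes f :: "'a::real_normed_vector \<Rightarrow> real"
  assumes "open S" "x \<in> S"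
    and f: "\<And>y. y \<in> S \<Longrightarrow> (f has_derivative f' y) (at y within S)"
    and D: "\<And>y. y \<in> S \<Longrightarrow> ((\<lambda>y. f' y d) has_derivative D y) (at y within S)"
    and E: "\<And>y. y \<in> S \<Longrightarrow> ((\<lambda>y. f' y e) has_derivative E y) (at y within S)"
    and cont: "continuous_on S (\<lambda>y. D y e)" "continuous_on S (\<lambda>y. E y d)"
  shows "D x e = E x d"
proof (rule ccontr)
  assume "D x e \<noteq> E x d"
  \<comment> \<open>Half the supposed gap: two deviations below \<open>\<eta>\<close> cannot bridge
    it.\<close>
  define \<eta> where "\<eta> = \<bar>D x e - E x d\<bar> / 2"
  have "\<eta> > 0" using \<open>D x e \<noteq> E x d\<close> by (simp add: \<eta>_def)
  obtain r0 where r0: "r0 > 0" "ball x r0 \<subseteq> S"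
    using assms(1,2) openE by blast
  obtain r1 where r1: "r1 > 0" "\<And>y. y \<in> S \<Longrightarrow> dist y x < r1 \<Longrightarrow> \<bar>D y e - D x e\<bar> < \<eta>"
    using cont(1) \<open>\<eta> > 0\<close> \<open>x \<in> S\<close> unfolding continuous_on_iff dist_real_def by metis
  obtain r2 where r2: "r2 > 0" "\<And>y. y \<in> S \<Longrightarrow> dist y x < r2 \<Longrightarrow> \<bar>E y d - E x d\<bar> < \<eta>"
    using cont(2) \<open>\<eta> > 0\<close> \<open>x \<in> S\<close> unfolding continuous_on_iff dist_real_def by metis
  define r where "r = min r0 (min r1 r2)"
  \<comment> \<open>Keeps the whole parallelogram within distance \<open>r\<close> of
    \<open>x\<close>. The summand 1 makes the denominator positive and the estimate strict.\<close>
  define h where "h = r / (norm d + norm e + 1)"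
  have r: "r > 0" using r0 r1 r2 by (simp add: r_def)
  then have h: "h > 0" by (auto simp: h_def intro!: divide_pos_pos add_nonneg_pos)
  have near: "dist (x + s *\<^sub>R d + t *\<^sub>R e) x < r" if "0 \<le> s" "s \<le> h" "0 \<le> t" "t \<le> h" for s t
  proof -
    have "dist (x + s *\<^sub>R d + t *\<^sub>R e) x \<le> norm (s *\<^sub>R d) + norm (t *\<^sub>R e)"
      by (simp add: dist_norm add.assoc norm_triangle_ineq del: norm_scaleR)
    also have "\<dots> \<le> h * norm d + h * norm e"
      using that by (auto intro!: add_mono mult_right_mono)
    also have "\<dots> < h * (norm d + norm e + 1)"
      using h by (simp add: algebra_simps)
    also have "\<dots> = r"
      by (simp add: h_def add_nonneg_eq_0_iff)
    finally show ?thesis .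
  qed
  have inS: "x + s *\<^sub>R d + t *\<^sub>R e \<in> S" if "0 \<le> s" "s \<le> h" "0 \<le> t" "t \<le> h" for s t
    using near[OF that] r0 by (auto simp: r_def dist_commute)
  obtain s t where st: "0 \<le> s" "s \<le> h" "0 \<le> t" "t \<le> h"
    "f (x + h *\<^sub>R d + h *\<^sub>R e) - f (x + h *\<^sub>R d) - f (x + h *\<^sub>R e) + f x
      = h * (h * D (x + s *\<^sub>R d + t *\<^sub>R e) e)"
    using second_difference_mvt[OF f D less_imp_le[OF h] inS] by blast
  have inS': "x + s *\<^sub>R e + t *\<^sub>R d \<in> S" if "0 \<le> s" "s \<le> h" "0 \<le> t" "t \<le> h" for s t
    using inS[OF that(3,4,1,2)] by (simp add: algebra_simps)
  obtain s' t' where st': "0 \<le> s'" "s' \<le> h" "0 \<le> t'" "t' \<le> h"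
    "f (x + h *\<^sub>R e + h *\<^sub>R d) - f (x + h *\<^sub>R e) - f (x + h *\<^sub>R d) + f x
      = h * (h * E (x + s' *\<^sub>R e + t' *\<^sub>R d) d)"
    using second_difference_mvt[OF f E less_imp_le[OF h] inS'] by blast
  have comm: "x + u *\<^sub>R e + v *\<^sub>R d = x + v *\<^sub>R d + u *\<^sub>R e" for u v
    by (simp add: algebra_simps)
  have "h * (h * D (x + s *\<^sub>R d + t *\<^sub>R e) e) = h * (h * E (x + t' *\<^sub>R d + s' *\<^sub>R e) d)"
    using st(5) st'(5)[unfolded comm[of h h] comm[of s' t']] by linarith
  then have "D (x + s *\<^sub>R d + t *\<^sub>R e) e = E (x + t' *\<^sub>R d + s' *\<^sub>R e) d"
    using h by simp
  moreover have "\<bar>D (x + s *\<^sub>R d + t *\<^sub>R e) e - D x e\<bar> < \<eta>"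
    using r1(2) inS near st by (simp add: r_def)
  moreover have "\<bar>E (x + t' *\<^sub>R d + s' *\<^sub>R e) d - E x d\<bar> < \<eta>"
    using r2(2) inS near st' by (simp add: r_def)
  ultimately have "\<bar>D x e - E x d\<bar> < 2 * \<eta>"
    by linarith
  then show False
    by (simp add: \<eta>_def)
qed

section \<open>Rayleigh quotients of symmetric matrices\<close>

text \<open>The quadratic form attains its minimum \<open>m\<close> on the unit sphere. The
  minimizer is an eigenvector for \<open>m\<close>, since otherwise moving it along its eigenvalue
  residual \<open>w\<close> would lower the quotient; so \<open>lam\<close> is at most
  \<open>m\<close>.\<close>

lemma smallest_eigenvalue_le_Rayleigh:
  fixes A :: "real^'p^'p"
  assumes sym: "transpose A = A" and lam: "smallest_eigenvalue A lam"
  shows "lam * (norm v)\<^sup>2 \<le> v \<bullet> (A *v v)"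
proof -
  define S where "S = sphere (0 :: real^'p) 1"
  have "compact S" "S \<noteq> {}"
    by (simp_all add: S_def)
  moreover have "continuous_on S (\<lambda>v. v \<bullet> (A *v v))"
    by (intro continuous_on_inner continuous_on_id matrix_vector_mult_linear_continuous_on)
  ultimately obtain v0 where v0: "v0 \<in> S" "\<And>v. v \<in> S \<Longrightarrow> v0 \<bullet> (A *v v0) \<le> v \<bullet> (A *v v)"
    using continuous_attains_inf[of S "\<lambda>v. v \<bullet> (A *v v)"] by auto
  define m where "m = v0 \<bullet> (A *v v0)"
  have m: "m * (norm v)\<^sup>2 \<le> v \<bullet> (A *v v)" for v
  proof (cases "v = 0")
    case False
    then have "inverse (norm v) *\<^sub>R v \<in> S" by (simp add: S_def)
    then have "m \<le> (inverse (norm v))\<^sup>2 * (v \<bullet> (A *v v))"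
      using v0(2) by (fastforce simp: m_def matrix_vector_mult_scaleR power2_eq_square)
    then have "m * (norm v)\<^sup>2 \<le> (inverse (norm v))\<^sup>2 * (v \<bullet> (A *v v)) * (norm v)\<^sup>2"
      by (simp only: mult_right_mono zero_le_power2)
    also have "\<dots> = v \<bullet> (A *v v)"
      using False by (simp add: power_inverse)
    finally show ?thesis .
  qed simp
  have "norm v0 = 1" using v0(1) by (simp add: S_def)
  define w where "w = A *v v0 - m *\<^sub>R v0"
  \<comment> \<open>Symmetry of \<open>A\<close> enters here and merges the two cross terms of the
    quadratic form.\<close>
  have swap: "w \<bullet> (A *v v0) = v0 \<bullet> (A *v w)"
    using dot_lmul_matrix[of w A v0] transpose_matrix_vector[of A w] by (simp add: sym inner_commute)
  have "w = 0"
  proof (rule ccontr)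
    assume "w \<noteq> 0"
    define c where "c = w \<bullet> (A *v w) - m * (norm w)\<^sup>2"
    \<comment> \<open>The inequality \<open>m\<close> at \<open>v0 + t *\<^sub>R w\<close>. The
      terms with \<open>w \<bullet> v0\<close> cancel, leaving a first-order term in
      \<open>t\<close> that is nonzero when \<open>w\<close> is.\<close>
    have quad: "0 \<le> 2 * t * (norm w)\<^sup>2 + t\<^sup>2 * c" for t
    proof -
      have "w \<bullet> (A *v v0 - m *\<^sub>R v0) = (norm w)\<^sup>2"
        by (simp only: w_def power2_norm_eq_inner)
      then have "w \<bullet> (A *v v0) = (norm w)\<^sup>2 + m * (w \<bullet> v0)"
        by (simp add: inner_diff_right)
      moreover have "(v0 + t *\<^sub>R w) \<bullet> (A *v (v0 + t *\<^sub>R w))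
          = m + 2 * t * (w \<bullet> (A *v v0)) + t\<^sup>2 * (w \<bullet> (A *v w))"
        using swap by (simp add: matrix_vector_right_distrib matrix_vector_mult_scaleR
            inner_add_left inner_add_right m_def power2_eq_square distrib_left)
      moreover have "(norm (v0 + t *\<^sub>R w))\<^sup>2 = 1 + 2 * t * (w \<bullet> v0) + t\<^sup>2 * (norm w)\<^sup>2"
        using \<open>norm v0 = 1\<close> unfolding power2_norm_eq_inner
        by (simp add: inner_add_left inner_add_right inner_commute[of v0 w] power2_eq_square distrib_left
            norm_eq_1)
      moreover have "m * (norm (v0 + t *\<^sub>R w))\<^sup>2 \<le> (v0 + t *\<^sub>R w) \<bullet> (A *v (v0 + t *\<^sub>R w))"
        by (rule m)
      ultimately show ?thesis by (simp add: c_def algebra_simps)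
    qed
    define N where "N = (norm w)\<^sup>2"
    have N: "N > 0" using \<open>w \<noteq> 0\<close> by (simp add: N_def)
    \<comment> \<open>Negative, and small enough that \<open>t * c\<close> is at least
      \<open>- N\<close>. The second-order term then cannot compensate the first-order one.\<close>
    define t where "t = - N / (\<bar>c\<bar> + 1)"
    have "t < 0" using N by (simp add: t_def divide_neg_pos)
    have "0 \<le> t * (2 * N + t * c)"
      using quad[of t] by (simp add: N_def power2_eq_square algebra_simps)
    then have "2 * N + t * c \<le> 0"
      using \<open>t < 0\<close> by (simp add: zero_le_mult_iff)
    moreover have "- N \<le> t * c"
    proof -
      have "\<bar>t * c\<bar> \<le> \<bar>t\<bar> * (\<bar>c\<bar> + 1)" by (simp add: abs_mult mult_left_mono)
      also have "\<dots> = N" using N by (simp add: t_def)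
      finally show ?thesis by linarith
    qed
    ultimately show False using N by linarith
  qed
  then have "A *v v0 = m *\<^sub>R v0" by (simp add: w_def)
  moreover have "v0 \<noteq> 0" using \<open>norm v0 = 1\<close> by auto
  ultimately have "lam \<le> m"
    using lam unfolding smallest_eigenvalue_def by blast
  then have "lam * (norm v)\<^sup>2 \<le> m * (norm v)\<^sup>2" by (simp add: mult_right_mono)
  with m[of v] show ?thesis by linarith
qed

section \<open>Gradient and Hessian up to the boundary of the box\<close>

lemma linear_eq_inner_axis:
  fixes L :: "real^'p \<Rightarrow> real"
  assumes "linear L"
  shows "L h = (\<chi> i. L (axis i 1)) \<bullet> h"
proof -
  have "L h = L (\<Sum>i\<in>UNIV. (h $ i) *\<^sub>R axis i 1)"
    by (simp add: basis_expansion flip: scalar_mult_eq_scaleR)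
  also have "\<dots> = (\<Sum>i\<in>UNIV. h $ i * L (axis i 1))"
    by (simp add: linear_sum[OF assms] linear_scale[OF assms])
  finally show ?thesis
    by (simp add: inner_vec_def mult.commute)
qed

text \<open>Connects the derivatives provided by \<open>Ck_on\<close> with those picked by
  \<open>frechet_derivative\<close>. As the box is nondegenerate, derivatives within it are unique
  even at boundary points.\<close>

lemma Ck_on_2_cbox_obtain_partials:
  fixes f :: "real^'p \<Rightarrow> real"
  assumes f: "Ck_on 2 (cbox a b) f" and ab: "\<forall>i. a $ i < b $ i"
  obtains D where
    "\<And>x. x \<in> cbox a b \<Longrightarrow> (f has_derivative (\<lambda>h. gradient (cbox a b) f x \<bullet> h)) (at x within cbox a b)"
    "\<And>i x. x \<in> cbox a b \<Longrightarrow>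
      ((\<lambda>y. gradient (cbox a b) f y $ i) has_derivative D i x) (at x within cbox a b)"
    "\<And>i h. continuous_on (cbox a b) (\<lambda>x. D i x h)"
    "\<And>i j x. x \<in> cbox a b \<Longrightarrow> hessian (cbox a b) f x $ i $ j = D j x (axis i 1)"
proof -
  let ?P = "cbox a b"
  have param: "param_deriv ?P i g x = g' (axis i 1)"
    if "x \<in> ?P" "(g has_derivative g') (at x within ?P)" for x i g' and g :: "real^'p \<Rightarrow> real"
  proof -
    have "frechet_derivative g (at x within ?P) = g'"
      by (rule frechet_derivative_within_cbox[OF _ that])
        (use ab in \<open>auto simp: Basis_vec_def inner_axis\<close>)
    then show ?thesis by (simp add: param_deriv_def)
  qed
  have "Ck_on (Suc (Suc 0)) ?P f"
    using f by (simp add: numeral_2_eq_2 del: Ck_on.simps)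
  then obtain f' where
    f': "\<And>x. x \<in> ?P \<Longrightarrow> (f has_derivative f' x) (at x within ?P)"
    and C1: "\<And>h. Ck_on (Suc 0) ?P (\<lambda>x. f' x h)"
    by (subst (asm) Ck_on.simps(2)) blast
  have grad: "gradient ?P f x $ i = f' x (axis i 1)" if "x \<in> ?P" for x i
    using param[OF that f'[OF that]] by (simp add: gradient_def)
  have "\<forall>i. \<exists>D. (\<forall>x\<in>?P. ((\<lambda>y. f' y (axis i 1)) has_derivative D x) (at x within ?P)) \<and>
      (\<forall>h. continuous_on ?P (\<lambda>x. D x h))"
    using C1 by simp
  then obtain D where
    D: "\<And>i x. x \<in> ?P \<Longrightarrow> ((\<lambda>y. f' y (axis i 1)) has_derivative D i x) (at x within ?P)"
    and cont: "\<And>i h. continuous_on ?P (\<lambda>x. D i x h)"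
    by metis
  have D': "((\<lambda>y. gradient ?P f y $ i) has_derivative D i x) (at x within ?P)" if "x \<in> ?P" for i x
    by (rule has_derivative_transform[OF that _ D[OF that]]) (rule grad)
  show ?thesis
  proof (rule that[OF _ D' cont])
    fix x assume x: "x \<in> ?P"
    have "f' x = (\<lambda>h. gradient ?P f x \<bullet> h)"
    proof
      fix h
      have "(\<chi> i. f' x (axis i 1)) = gradient ?P f x"
        by (simp add: vec_eq_iff grad[OF x])
      then show "f' x h = gradient ?P f x \<bullet> h"
        using linear_eq_inner_axis[OF has_derivative_linear[OF f'[OF x]], of h] by simp
    qed
    with f'[OF x] show "(f has_derivative (\<lambda>h. gradient ?P f x \<bullet> h)) (at x within ?P)"
      by simp
    show "hessian ?P f x $ i $ j = D j x (axis i 1)" for i j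
      using param[OF x D'[OF x]] by (simp add: hessian_def gradient_def)
  qed
qed

text \<open>The gradient is differentiated after pairing with a fixed \<open>d\<close>. This keeps
  the function real-valued, as the mean value theorem along a segment requires.\<close>

lemma
  fixes f :: "real^'p \<Rightarrow> real"
  assumes f: "Ck_on 2 (cbox a b) f" and ab: "\<forall>i. a $ i < b $ i"
  shows has_derivative_gradient_cbox:
      "\<And>x. x \<in> cbox a b \<Longrightarrow>
        (f has_derivative (\<lambda>h. gradient (cbox a b) f x \<bullet> h)) (at x within cbox a b)"
    and gradient_has_derivative_hessian_cbox:
      "\<And>x d. x \<in> cbox a b \<Longrightarrow>
        ((\<lambda>y. gradient (cbox a b) f y \<bullet> d) has_derivative (\<lambda>h. h \<bullet> (hessian (cbox a b) f x *v d)))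
          (at x within cbox a b)"
    and continuous_on_hessian_cbox: "continuous_on (cbox a b) (hessian (cbox a b) f)"
    and transpose_hessian_cbox:
      "\<And>x. x \<in> cbox a b \<Longrightarrow> transpose (hessian (cbox a b) f x) = hessian (cbox a b) f x"
proof -
  let ?P = "cbox a b" and ?H = "hessian (cbox a b) f" and ?g = "gradient (cbox a b) f"
  obtain D where
    g: "\<And>x. x \<in> ?P \<Longrightarrow> (f has_derivative (\<lambda>h. ?g x \<bullet> h)) (at x within ?P)"
    and D: "\<And>i x. x \<in> ?P \<Longrightarrow> ((\<lambda>y. ?g y $ i) has_derivative D i x) (at x within ?P)"
    and cont: "\<And>i h. continuous_on ?P (\<lambda>x. D i x h)"
    and H: "\<And>i j x. x \<in> ?P \<Longrightarrow> ?H x $ i $ j = D j x (axis i 1)"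
    using Ck_on_2_cbox_obtain_partials[OF f ab] by blast
  show "\<And>x. x \<in> ?P \<Longrightarrow> (f has_derivative (\<lambda>h. ?g x \<bullet> h)) (at x within ?P)"
    by (rule g)
  show "((\<lambda>y. ?g y \<bullet> d) has_derivative (\<lambda>h. h \<bullet> (?H x *v d))) (at x within ?P)"
    if x: "x \<in> ?P" for x d
  proof -
    \<comment> \<open>Column \<open>j\<close> of the Hessian holds the derivative of gradient
      component \<open>j\<close>, hence the product \<open>?H x *v d\<close> below without a
      transpose.\<close>
    have "D j x h = (\<Sum>i\<in>UNIV. ?H x $ i $ j * h $ i)" for j h
      using linear_eq_inner_axis[OF has_derivative_linear[OF D[OF x]], of j h]
      by (simp add: inner_vec_def H[OF x])
    then have "(\<lambda>h. \<Sum>j\<in>UNIV. D j x h * d $ j) = (\<lambda>h. h \<bullet> (?H x *v d))"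
      by (auto simp: fun_eq_iff inner_vec_def matrix_vector_mult_def sum_distrib_left
          sum_distrib_right mult_ac intro: sum.swap)
    moreover have "((\<lambda>y. \<Sum>j\<in>UNIV. ?g y $ j * d $ j) has_derivative
        (\<lambda>h. \<Sum>j\<in>UNIV. D j x h * d $ j)) (at x within ?P)"
      by (intro has_derivative_sum has_derivative_mult_left D x)
    ultimately show ?thesis
      by (simp add: inner_vec_def)
  qed
  have contH: "continuous_on ?P (\<lambda>x. ?H x $ i $ j)" for i j
    using cont[of j "axis i 1"] by (rule continuous_on_eq) (simp add: H)
  then have "continuous_on ?P (\<lambda>x. \<chi> i j. ?H x $ i $ j)"
    by (intro continuous_on_vec_lambda)
  then show "continuous_on ?P ?H"
    by simp
  show "transpose (?H x) = ?H x" if x: "x \<in> ?P" for x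
  proof -
    have sym: "?H y $ i $ j - ?H y $ j $ i = 0" if y: "y \<in> box a b" for i j y
    proof -
      have sub: "box a b \<subseteq> ?P" by (rule box_subset_cbox)
      have "D j y (axis i 1) = D i y (axis j 1)"
      proof (rule symmetric_second_derivative_open[where S = "box a b" and f = f
            and f' = "\<lambda>x h. ?g x \<bullet> h" and D = "D j" and E = "D i"])
        show "(f has_derivative (\<bullet>) (?g z)) (at z within box a b)" if "z \<in> box a b" for z
          using g sub that by (blast intro: has_derivative_subset)
        show "((\<lambda>y. ?g y \<bullet> axis k 1) has_derivative D k z) (at z within box a b)"
          if "z \<in> box a b" for z k
          using D sub that by (auto simp: inner_axis intro: has_derivative_subset)
        then show "((\<lambda>y. ?g y \<bullet> axis i 1) has_derivative D i z) (at z within box a b)"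
          if "z \<in> box a b" for z
          using that by blast
      qed (use y cont sub in \<open>auto intro: continuous_on_subset\<close>)
      then show ?thesis using H sub y by auto
    qed
    have "box a b \<noteq> {}"
      using ab by (simp add: interval_ne_empty_cart)
    then have closure: "closure (box a b) = ?P" by simp
    \<comment> \<open>The difference of mirrored entries is continuous on the box and vanishes on
      its dense interior.\<close>
    have "?H x $ i $ j - ?H x $ j $ i = 0" for i j
      using continuous_constant_on_closure[of "box a b" "\<lambda>x. ?H x $ i $ j - ?H x $ j $ i" 0 x]
        sym x contH by (simp add: closure continuous_on_diff)
    then show ?thesis
      by (simp add: vec_eq_iff transpose_def)
  qed
qed

section \<open>Stability of coercivity, first-order conditions and the error bound\<close>

text \<open>The sum \<open>F y\<close> of absolute entries of \<open>H x - H y\<close> bounds its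
  operator norm. It is continuous and 0 at \<open>x\<close>, so near \<open>x\<close> the quadratic
  form loses less than \<open>lam - lam'\<close> times the squared norm.\<close>

lemma matrix_coercive_near:
  fixes H :: "'a::metric_space \<Rightarrow> real^'p^'p"
  assumes H: "continuous_on S H" and x: "x \<in> S"
    and pos: "\<And>v. lam * (norm v)\<^sup>2 \<le> v \<bullet> (H x *v v)" and "lam' < lam"
  shows "\<exists>r>0. \<forall>y\<in>S \<inter> cball x r. \<forall>v. lam' * (norm v)\<^sup>2 \<le> v \<bullet> (H y *v v)"
proof -
  define F where "F y = (\<Sum>i\<in>UNIV. \<Sum>j\<in>UNIV. \<bar>(H x - H y) $ i $ j\<bar>)" for y
  have "continuous_on S F"
    unfolding F_def by (intro continuous_intros H)
  then obtain \<delta> where \<delta>: "\<delta> > 0" "\<And>y. y \<in> S \<Longrightarrow> dist y x < \<delta> \<Longrightarrow> dist (F y) (F x) < lam - lam'"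
    using x \<open>lam' < lam\<close> unfolding continuous_on_iff by (metis diff_gt_0_iff_gt)
  \<comment> \<open>Half of \<open>\<delta>\<close>, so that the closed ball fits into the open ball
    from continuity.\<close>
  have "lam' * (norm v)\<^sup>2 \<le> v \<bullet> (H y *v v)" if "y \<in> S" "y \<in> cball x (\<delta> / 2)" for y v
  proof -
    have "F y < lam - lam'"
      using \<delta>(2)[OF that(1)] that(2) \<delta>(1) by (auto simp: F_def dist_real_def dist_commute)
    have "v \<bullet> ((H x - H y) *v v) \<le> norm v * norm ((H x - H y) *v v)"
      by (rule norm_cauchy_schwarz)
    also have "\<dots> \<le> norm v * (onorm ((*v) (H x - H y)) * norm v)"
      by (intro mult_left_mono onorm) (auto simp: matrix_vector_mul_bounded_linear)
    also have "\<dots> \<le> norm v * (F y * norm v)"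
      unfolding F_def by (intro mult_left_mono mult_right_mono onorm_le_matrix_component_sum) auto
    also have "\<dots> \<le> norm v * ((lam - lam') * norm v)"
      using \<open>F y < lam - lam'\<close> by (intro mult_left_mono mult_right_mono) auto
    finally show ?thesis
      using pos[of v]
      by (simp add: matrix_vector_mult_diff_rdistrib inner_diff_right power2_eq_square algebra_simps)
  qed
  then show ?thesis
    using \<delta>(1) by (intro exI[of _ "\<delta> / 2"]) auto
qed

text \<open>With a negative slope, \<open>f\<close> would decrease strictly on the segment from
  \<open>x\<close> towards \<open>y\<close>, which stays in \<open>S\<close> by convexity.\<close>

lemma strict_local_min_on_gradient_nonneg:
  assumes min: "strict_local_min_on S f x" and "convex S" and y: "y \<in> S"
    and f: "(f has_derivative (\<lambda>h. g \<bullet> h)) (at x within S)"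
  shows "0 \<le> g \<bullet> (y - x)"
proof (rule ccontr)
  assume neg: "\<not> 0 \<le> g \<bullet> (y - x)"
  obtain \<delta> where x: "x \<in> S" and "\<delta> > 0"
    and \<delta>: "\<And>z. z \<in> S \<inter> ball x \<delta> \<Longrightarrow> z \<noteq> x \<Longrightarrow> f x < f z"
    using min unfolding strict_local_min_on_def by blast
  define \<gamma> where "\<gamma> t = x + t *\<^sub>R (y - x)" for t
  have \<gamma>: "\<gamma> t \<in> S" if "t \<in> {0..1}" for t
    using convexD_alt[OF \<open>convex S\<close> x y, of t] that by (simp add: \<gamma>_def algebra_simps)
  \<comment> \<open>Only a one-sided derivative at 0 is available, because \<open>x\<close> may lie
    on the boundary of \<open>S\<close>.\<close>
  have "((\<lambda>t. f (\<gamma> t)) has_derivative (\<lambda>s. g \<bullet> (s *\<^sub>R (y - x)))) (at 0 within {0..1})"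
  proof (rule has_derivative_in_compose[where f = \<gamma> and g = f
        and f' = "\<lambda>s. s *\<^sub>R (y - x)" and g' = "\<lambda>v. g \<bullet> v"])
    show "(\<gamma> has_derivative (\<lambda>s. s *\<^sub>R (y - x))) (at 0 within {0..1})"
      unfolding \<gamma>_def[abs_def] by (auto intro!: derivative_eq_intros)
    have "\<gamma> 0 = x" by (simp add: \<gamma>_def)
    moreover have "\<gamma> ` {0..1} \<subseteq> S" using \<gamma> by blast
    ultimately show "(f has_derivative (\<bullet>) g) (at (\<gamma> 0) within \<gamma> ` {0..1})"
      using f by (simp add: has_derivative_subset)
  qed
  then have "((\<lambda>t. f (\<gamma> t)) has_real_derivative g \<bullet> (y - x)) (at 0 within {0..1})"
    by (simp add: has_field_derivative_def mult.commute[of _ "g \<bullet> (y - x)"])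
  then obtain h0 where "h0 > 0" and
    h0: "\<And>h. h > 0 \<Longrightarrow> h \<in> {0..1} \<Longrightarrow> h < h0 \<Longrightarrow> f (\<gamma> h) < f (\<gamma> 0)"
    using has_real_derivative_neg_dec_right[of "\<lambda>t. f (\<gamma> t)" "g \<bullet> (y - x)" 0 "{0..1}"] neg by auto
  define N where "N = norm (y - x) + 1"
  \<comment> \<open>The three bounds keep the point on the segment, in the range of decrease, and
    within \<open>\<delta>\<close> of \<open>x\<close>.\<close>
  define h where "h = min 1 (min (h0 / 2) (\<delta> / (2 * N)))"
  have N: "N > 0" by (simp add: N_def add_nonneg_pos)
  have h: "h > 0" "h \<in> {0..1}" "h < h0"
    using \<open>h0 > 0\<close> \<open>\<delta> > 0\<close> N by (auto simp: h_def)
  have "h * norm (y - x) \<le> h * N"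
    using h by (simp add: N_def)
  also have "\<dots> \<le> \<delta> / (2 * N) * N"
    using N by (intro mult_right_mono) (auto simp: h_def)
  also have "\<dots> < \<delta>"
    using N \<open>\<delta> > 0\<close> by simp
  finally have "\<gamma> h \<in> ball x \<delta>"
    using h by (simp add: \<gamma>_def dist_norm)
  moreover have "f (\<gamma> h) < f x"
    using h0[OF h] by (simp add: \<gamma>_def)
  ultimately show False
    using \<delta>[of "\<gamma> h"] \<gamma>[OF h(2)] by fastforce
qed

text \<open>Adding \<open>zeta\<close> leaves only the positive part of the gradient on a lower
  face, the negative part on an upper face, and 0 elsewhere. Each matches the sign of
  \<open>y - x\<close> there, so \<open>x\<close> becomes first-order critical for the perturbed
  gradient.\<close>

lemma gradient_plus_zeta_nonneg:
  assumes "x \<in> cbox a b" "y \<in> cbox a b"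
  shows "0 \<le> (gradient (cbox a b) f x + zeta a b f x) \<bullet> (y - x)"
  unfolding inner_vec_def
proof (rule sum_nonneg)
  fix i
  have "a $ i \<le> y $ i" "y $ i \<le> b $ i"
    using assms by (auto simp: mem_box_cart)
  then show "0 \<le> (gradient (cbox a b) f x + zeta a b f x) $ i \<bullet> (y - x) $ i"
    by (auto simp: zeta_def Let_def min_def max_def mult_nonneg_nonneg mult_nonpos_nonpos)
qed

lemma local_min_error_bound:
  fixes f :: "real^'p \<Rightarrow> real"
  assumes f: "Ck_on 2 (cbox a b) f" and ab: "\<forall>i. a $ i < b $ i"
    and min: "strict_local_min_on (cbox a b) f x" and y: "y \<in> cbox a b \<inter> cball x r"
    and "lam > 0"
    and pos: "\<And>z v. z \<in> cbox a b \<inter> cball x r \<Longrightarrow>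
      lam * (norm v)\<^sup>2 \<le> v \<bullet> (hessian (cbox a b) f z *v v)"
  shows "norm (x - y) \<le> norm (zeta a b f y) / lam"
proof -
  let ?P = "cbox a b" and ?g = "gradient (cbox a b) f"
  define d where "d = y - x"
  have x: "x \<in> ?P" using min by (simp add: strict_local_min_on_def)
  \<comment> \<open>Nonnegativity of \<open>r\<close> puts the center \<open>x\<close> into its
    ball, hence the segment too by convexity.\<close>
  have "r \<ge> 0" using y by (auto intro: order_trans[OF zero_le_dist])
  then have seg: "x + t *\<^sub>R d \<in> ?P \<inter> cball x r" if "0 \<le> t" "t \<le> 1" for t
    using convexD_alt[of "?P \<inter> cball x r" x y t] x y that
    by (simp add: d_def algebra_simps convex_Int)
  obtain t where t: "0 \<le> t" "t \<le> 1"
    "?g (x + 1 *\<^sub>R d) \<bullet> d - ?g x \<bullet> d = 1 * (d \<bullet> (hessian ?P f (x + t *\<^sub>R d) *v d))"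
    by (rule mvt_direction[OF gradient_has_derivative_hessian_cbox[OF f ab, of _ d], of 1 x d])
      (use seg in auto)
  have "lam * (norm d)\<^sup>2 \<le> ?g y \<bullet> d - ?g x \<bullet> d"
    using pos[OF seg[OF t(1,2)], of d] t(3) by (simp add: d_def)
  also have "\<dots> \<le> ?g y \<bullet> d"
    using strict_local_min_on_gradient_nonneg[OF min convex_box(1) _
        has_derivative_gradient_cbox[OF f ab x], of y] y
    by (simp add: d_def)
  \<comment> \<open>The perturbed variational inequality at \<open>y\<close>, tested with the
    minimum \<open>x\<close>.\<close>
  also have "\<dots> \<le> - (zeta a b f y \<bullet> d)"
    using gradient_plus_zeta_nonneg[of y a b x f] x y
    by (simp add: d_def inner_add_left inner_diff_right)
  also have "\<dots> \<le> norm (zeta a b f y) * norm d"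
    using norm_cauchy_schwarz[of "- zeta a b f y" d] by simp
  finally have "(lam * norm d) * norm d \<le> norm (zeta a b f y) * norm d"
    by (simp add: power2_eq_square)
  then have "lam * norm d \<le> norm (zeta a b f y)"
    by (cases "d = 0") auto
  then show ?thesis
    using \<open>lam > 0\<close> by (simp add: d_def norm_minus_commute field_simps)
qed

theorem proposition2p7:
  fixes \<mu>a \<mu>b \<mu>h :: "real^'p"
    and P :: "(real^'p) set"
    and a k :: "real^'p \<Rightarrow> 'v::{real_inner,complete_space} \<Rightarrow>\<^sub>L 'v \<Rightarrow>\<^sub>L real"
    and l j :: "real^'p \<Rightarrow> 'v \<Rightarrow>\<^sub>L real"
    and \<Theta> Jh :: "real^'p \<Rightarrow> real"
    and Vh :: "'v set"
    and \<epsilon> lam_min :: real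
  assumes box: "P = cbox \<mu>a \<mu>b" "\<forall>i. \<mu>a $ i < \<mu>b $ i"
    and Vh: "subspace Vh" "\<exists>B. finite B \<and> span B = Vh"
    and coercive: "\<forall>\<mu>\<in>P. coercive (a \<mu>)"
    and symmetric: "\<forall>\<mu>\<in>P. \<forall>u v. k \<mu> u v = k \<mu> v u"
    and separable: "param_separable P a" "param_separable P l"
      "param_separable P j" "param_separable P k"
    and smooth: "C2_loc_lipschitz_on P a" "C2_loc_lipschitz_on P l"
      "\<forall>u. C2_loc_lipschitz_on P (cost \<Theta> j k u)"
    and truth: "truth_assumption \<epsilon> P a l j k Vh"
    and Jh: "Jh = J_full a l \<Theta> j k Vh"
    and min_h: "strict_local_min_on P Jh \<mu>h"
    and SOC: "second_order_condition P Jh \<mu>h lam_min"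
  shows "\<exists>r. coercivity_radius P Jh \<mu>h lam_min r \<and>
    (\<forall>Vpr Vdu \<mu>r.
       subspace Vpr \<and> Vpr \<subseteq> Vh \<and> subspace Vdu \<and> Vdu \<subseteq> Vh \<and>
       strict_local_min_on P (J_red a l \<Theta> j k Vpr Vdu) \<mu>r \<and>
       \<mu>r \<in> cball \<mu>h (r (lam_min / 2)) \<longrightarrow>
       norm (\<mu>h - \<mu>r) \<le> 2 / lam_min * norm (zeta \<mu>a \<mu>b Jh \<mu>r))"
proof -
  obtain B where B: "finite B" "span B = Vh" using Vh(2) by blast
  have C2: "Ck_on 2 (cbox \<mu>a \<mu>b) Jh"
    unfolding Jh
    by (rule J_full_Ck_on_2[OF Vh(1) B]) (use coercive symmetric smooth box(1) in auto)
  have \<mu>h: "\<mu>h \<in> P" using min_h by (simp add: strict_local_min_on_def)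
  have lam_min: "lam_min > 0" "smallest_eigenvalue (hessian P Jh \<mu>h) lam_min"
    using SOC by (auto simp: second_order_condition_def)
  have "transpose (hessian P Jh \<mu>h) = hessian P Jh \<mu>h"
    using transpose_hessian_cbox[OF C2 box(2)] \<mu>h by (simp add: box(1))
  note Rayleigh = smallest_eigenvalue_le_Rayleigh[OF this lam_min(2)]
  \<comment> \<open>Coercivity is required in all directions, since the difference of the two minima
    need not lie in the critical cone.\<close>
  have "\<exists>\<rho>>0. \<forall>\<mu>\<in>P \<inter> cball \<mu>h \<rho>. \<forall>\<nu>. lam * (norm \<nu>)\<^sup>2 \<le> \<nu> \<bullet> (hessian P Jh \<mu> *v \<nu>)"
    if "lam < lam_min" for lam
    by (rule matrix_coercive_near[OF _ \<mu>h _ that])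
      (use Rayleigh continuous_on_hessian_cbox[OF C2 box(2)] box(1) in auto)
  then obtain r where r: "\<And>lam. lam < lam_min \<Longrightarrow> r lam > 0 \<and>
      (\<forall>\<mu>\<in>P \<inter> cball \<mu>h (r lam). \<forall>\<nu>. lam * (norm \<nu>)\<^sup>2 \<le> \<nu> \<bullet> (hessian P Jh \<mu> *v \<nu>))"
    by metis
  have "coercivity_radius P Jh \<mu>h lam_min r"
    using r unfolding coercivity_radius_def coercive_on_cone_def by blast
  \<comment> \<open>Coercivity with constant \<open>lam_min / 2\<close> along the segment produces
    the factor \<open>2 / lam_min\<close>.\<close>
  moreover have "norm (\<mu>h - \<mu>r) \<le> 2 / lam_min * norm (zeta \<mu>a \<mu>b Jh \<mu>r)"
    if "\<mu>r \<in> P" "\<mu>r \<in> cball \<mu>h (r (lam_min / 2))" for \<mu>r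
    using local_min_error_bound[OF C2 box(2), of \<mu>h \<mu>r "r (lam_min / 2)" "lam_min / 2"]
      min_h that lam_min(1) r[of "lam_min / 2"]
    by (simp add: box(1) mult.commute)
  ultimately show ?thesis
    by (auto simp: strict_local_min_on_def)
qed

end
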